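(* Let $G$ be a discrete countable group and let $\sigma,\tau\in\operatorname{End}(G)$ be group endomorphisms. Let $\Gamma$ be the groupoid associated with $(G,\sigma,\tau)$ and $X(\Gamma)$ the complex vector space of locally finite characters on $\Gamma$. Let $\Psi:\mathcal{D}_{(\sigma,\tau)}(\mathbb{C}[G])\to X(\Gamma)$ be the map which sends a $(\sigma,\tau)$-derivation $D$ with $D(g)=\sum_{h\in G}\lambda_g^h h$ ($g\in G$, $\lambda_g^h\in\mathbb{C}$) to the function $\Psi(D)(h,g)=\lambda_g^h$. Then $\Psi$ is an isomorphism (of complex vector spaces), with inverse given by $\Psi^{-1}(\chi)(g)=\sum_{h\in G}\chi(h,g)h$ for $g\in G$.
   Context: The endomorphisms $\sigma,\tau$ are extended linearly to algebra endomorphisms of the group algebra $\mathbb{C}[G]$ (finitely supported formal sums). A $(\sigma,\tau)$-derivation of $\mathbb{C}[G]$ is a $\mathbb{C}$-linear map $D:\mathbb{C}[G]\to\mathbb{C}[G]$ with $D(ab)=D(a)\tau(b)+\sigma(a)D(b)$ for all $a,b$; $\mathcal{D}_{(\sigma,\tau)}(\mathbb{C}[G])$ is the vector space of all of them. The groupoid $\Gamma$: its set of objects is $G$; for objects $a,b$, $\operatorname{Hom}(a,b)=\{(u,v)\in G\times G : \sigma(v^{-1})u=a,\ u\tau(v^{-1})=b\}$ (so every pair $(u,v)\in G\times G$ is a morphism with source $\sigma(v^{-1})u$ and target $u\tau(v^{-1})$). For $\varphi=(u_1,v_1)\in\operatorname{Hom}(a,b)$ and $\psi=(u_2,v_2)\in\operatorname{Hom}(b,c)$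 the composition is $\varphi\circ\psi=(u_2\tau(v_1),v_2v_1)\in\operatorname{Hom}(a,c)$. Let $\operatorname{Hom}(\Gamma)=G\times G$ be the set of all morphisms. A character on $\Gamma$ is a map $\chi:\operatorname{Hom}(\Gamma)\to\mathbb{C}$ with $\chi(\varphi\circ\psi)=\chi(\varphi)+\chi(\psi)$ for all composable $\varphi,\psi$. It is locally finite if for each fixed $v\in G$ one has $\chi(u,v)=0$ for all but finitely many $u\in G$. Vector space operations on characters are pointwise. *)

theory Defs
  imports Complex_Main "HOL-Library.Poly_Mapping" "HOL-Library.Function_Algebras"
    "HOL-Library.Countable_Set"
begin

text \<open>
  Groups are types of class \<^class>\<open>group_add\<close>, which does not assume commutativity.
  The group operation is therefore written additively: \<open>g + h\<close> is the product \<open>gh\<close>,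
  \<open>- g\<close> is the inverse of \<open>g\<close> and \<open>0\<close> is the neutral element.  With this convention
  the group algebra over the complex numbers is the type of finitely supported functions of
  \<open>HOL-Library.Poly_Mapping\<close> with its convolution product; the basis element belonging to
  \<open>g\<close> is \<open>Poly_Mapping.single g 1\<close>.
\<close>

type_synonym 'g group_algebra = "'g \<Rightarrow>\<^sub>0 complex"

abbreviation basis_elt :: "'g \<Rightarrow> 'g group_algebra" where
  "basis_elt g \<equiv> Poly_Mapping.single g 1"

definition ga_scale :: "complex \<Rightarrow> 'g group_algebra \<Rightarrow> 'g group_algebra" where
  "ga_scale c a = Poly_Mapping.map ((*) c) a"

definition fun_scale :: "('k \<Rightarrow> 'v \<Rightarrow> 'v) \<Rightarrow> 'k \<Rightarrow> ('x \<Rightarrow> 'v) \<Rightarrow> 'x \<Rightarrow> 'v" where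
  "fun_scale s c f = (\<lambda>x. s c (f x))"

lemma lookup_ga_scale [simp]: "Poly_Mapping.lookup (ga_scale c a) g = c * Poly_Mapping.lookup a g"
  by (simp add: ga_scale_def Poly_Mapping.map.rep_eq when_def)

lemma ga_scale_single [simp]:
  "ga_scale c (Poly_Mapping.single g k) = Poly_Mapping.single g (c * k)"
  by (simp add: ga_scale_def)

lemma vector_space_ga_scale: "vector_space ga_scale"
  by unfold_locales (auto intro!: poly_mapping_eqI simp: lookup_add algebra_simps)

lemma vector_space_complex_mult: "vector_space ((*) :: complex \<Rightarrow> complex \<Rightarrow> complex)"
  by unfold_locales (auto simp: algebra_simps)

lemma vector_space_fun_scale:
  assumes "vector_space s"
  shows "vector_space (fun_scale s)"
proof -
  interpret vector_space s by fact
  show ?thesis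
    by unfold_locales
      (auto simp: fun_scale_def scale_right_distrib scale_left_distrib)
qed

lemma ga_scale_mult_left:
  fixes a b :: "'g::group_add group_algebra"
  shows "ga_scale c a * b = ga_scale c (a * b)"
  by (simp add: ga_scale_def mult_map_scale_conv_mult mult.assoc)

lemma ga_scale_mult_right:
  fixes a b :: "'g::group_add group_algebra"
  shows "a * ga_scale c b = ga_scale c (a * b)"
proof (rule poly_mapping_eqI)
  fix k
  have inner: "(\<Sum>q. f q when k = l + q) = f (- l + k)" for l and f :: "'g \<Rightarrow> complex"
  proof -
    have "(\<lambda>q. f q when k = l + q) = (\<lambda>q. f q when q = - l + k)"
      by (rule ext) (auto simp: when_def algebra_simps)
    then show ?thesis by (simp only: Sum_any_when_equal)
  qed
  have "Poly_Mapping.lookup (a * ga_scale c b) k = (\<Sum>l. c * (Poly_Mapping.lookup a l * Poly_Mapping.lookup b (- l + k)))"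
    by (simp only: lookup_mult inner lookup_ga_scale mult.left_commute)
  also have "\<dots> = c * (\<Sum>l. Poly_Mapping.lookup a l * Poly_Mapping.lookup b (- l + k))"
  proof (rule Sum_any_right_distrib [symmetric])
    show "finite {l. Poly_Mapping.lookup a l * Poly_Mapping.lookup b (- l + k) \<noteq> 0}"
      by (rule finite_subset [OF _ finite_lookup [of a]]) auto
  qed
  finally show "Poly_Mapping.lookup (a * ga_scale c b) k = Poly_Mapping.lookup (ga_scale c (a * b)) k"
    by (simp only: lookup_mult inner lookup_ga_scale)
qed

definition lin_ext :: "('g \<Rightarrow> 'g) \<Rightarrow> 'g group_algebra \<Rightarrow> 'g group_algebra" where
  "lin_ext \<sigma> a = (\<Sum>g\<in>Poly_Mapping.keys a. ga_scale (Poly_Mapping.lookup a g) (basis_elt (\<sigma> g)))"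

lemma lin_ext_single [simp]: "lin_ext \<sigma> (Poly_Mapping.single g c) = Poly_Mapping.single (\<sigma> g) c"
  by (simp add: lin_ext_def)

lemma lin_ext_superset:
  assumes "finite S" "Poly_Mapping.keys a \<subseteq> S"
  shows "lin_ext \<sigma> a = (\<Sum>g\<in>S. ga_scale (Poly_Mapping.lookup a g) (basis_elt (\<sigma> g)))"
  unfolding lin_ext_def
  by (rule sum.mono_neutral_left) (use assms in \<open>auto simp: in_keys_iff\<close>)

lemma lin_ext_add: "lin_ext \<sigma> (a + b) = lin_ext \<sigma> a + lin_ext \<sigma> b"
proof -
  let ?S = "Poly_Mapping.keys a \<union> Poly_Mapping.keys b"
  have "lin_ext \<sigma> (a + b) = (\<Sum>g\<in>?S. ga_scale (Poly_Mapping.lookup (a + b) g) (basis_elt (\<sigma> g)))"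
    by (rule lin_ext_superset) (use Poly_Mapping.keys_add [of a b] in auto)
  also have "\<dots> = (\<Sum>g\<in>?S. ga_scale (Poly_Mapping.lookup a g) (basis_elt (\<sigma> g)))
      + (\<Sum>g\<in>?S. ga_scale (Poly_Mapping.lookup b g) (basis_elt (\<sigma> g)))"
    by (simp add: lookup_add single_add sum.distrib)
  finally show ?thesis
    by (simp add: lin_ext_superset [of ?S])
qed

lemma single_sum_keys:
  fixes a :: "'g group_algebra"
  shows "a = (\<Sum>g\<in>Poly_Mapping.keys a. Poly_Mapping.single g (Poly_Mapping.lookup a g))"
proof (rule poly_mapping_eqI)
  fix k
  have "(\<Sum>g\<in>Poly_Mapping.keys a. Poly_Mapping.lookup a g when g = k) = (\<Sum>g\<in>Poly_Mapping.keys a. if g = k then Poly_Mapping.lookup a g else 0)"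
    by (simp add: when_def)
  also have "\<dots> = Poly_Mapping.lookup a k"
    by (subst sum.delta) (auto simp: in_keys_iff)
  finally show "Poly_Mapping.lookup a k = Poly_Mapping.lookup (\<Sum>g\<in>Poly_Mapping.keys a. Poly_Mapping.single g (Poly_Mapping.lookup a g)) k"
    by (simp add: lookup_sum lookup_single)
qed

lemma lin_ext_zero [simp]: "lin_ext \<sigma> 0 = 0"
  by (simp add: lin_ext_def)

lemma lin_ext_sum: "lin_ext \<sigma> (sum f A) = (\<Sum>x\<in>A. lin_ext \<sigma> (f x))"
  by (induction A rule: infinite_finite_induct) (simp_all add: lin_ext_add)

text \<open>The linear extension of a group endomorphism is an algebra endomorphism.\<close>

lemma lin_ext_mult:
  fixes a b :: "'g::group_add group_algebra"
  assumes "\<And>x y. \<sigma> (x + y) = \<sigma> x + \<sigma> y"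
  shows "lin_ext \<sigma> (a * b) = lin_ext \<sigma> a * lin_ext \<sigma> b"
proof -
  have 1: "lin_ext \<sigma> c = (\<Sum>g\<in>Poly_Mapping.keys c. Poly_Mapping.single (\<sigma> g) (Poly_Mapping.lookup c g))" for c
    by (simp add: lin_ext_def)
  have "a * b = (\<Sum>g\<in>Poly_Mapping.keys a. \<Sum>h\<in>Poly_Mapping.keys b. Poly_Mapping.single (g + h) (Poly_Mapping.lookup a g * Poly_Mapping.lookup b h))"
    by (subst single_sum_keys [of a], subst single_sum_keys [of b])
      (simp add: sum_product mult_single)
  then have "lin_ext \<sigma> (a * b) =
      (\<Sum>g\<in>Poly_Mapping.keys a. \<Sum>h\<in>Poly_Mapping.keys b. Poly_Mapping.single (\<sigma> g + \<sigma> h) (Poly_Mapping.lookup a g * Poly_Mapping.lookup b h))"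
    by (simp add: lin_ext_sum assms)
  then show ?thesis
    by (simp add: 1 sum_product mult_single)
qed

lemma lin_ext_ga_scale: "lin_ext \<sigma> (ga_scale c a) = ga_scale c (lin_ext \<sigma> a)"
proof -
  interpret vector_space "ga_scale :: complex \<Rightarrow> 'a group_algebra \<Rightarrow> _"
    by (rule vector_space_ga_scale)
  have "lin_ext \<sigma> (ga_scale c a) =
      (\<Sum>g\<in>Poly_Mapping.keys a. ga_scale (Poly_Mapping.lookup (ga_scale c a) g) (basis_elt (\<sigma> g)))"
    by (rule lin_ext_superset) (auto simp: in_keys_iff)
  then show ?thesis
    by (simp add: lin_ext_def scale_sum_right)
qed

definition derivations ::
    "('g::group_add \<Rightarrow> 'g) \<Rightarrow> ('g \<Rightarrow> 'g) \<Rightarrow> ('g group_algebra \<Rightarrow> 'g group_algebra) set" where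
  "derivations \<sigma> \<tau> = {D. Vector_Spaces.linear ga_scale ga_scale D \<and>
     (\<forall>a b. D (a * b) = D a * lin_ext \<tau> b + lin_ext \<sigma> a * D b)}"

text \<open>
  The groupoid: objects are the group elements and morphisms are the pairs of group elements.
  Composition is in diagrammatic order, first argument first.
\<close>

definition gHom :: "('g::group_add \<Rightarrow> 'g) \<Rightarrow> ('g \<Rightarrow> 'g) \<Rightarrow> 'g \<Rightarrow> 'g \<Rightarrow> ('g \<times> 'g) set" where
  "gHom \<sigma> \<tau> a b = {(u, v). \<sigma> (- v) + u = a \<and> u + \<tau> (- v) = b}"

fun gcomp :: "('g::group_add \<Rightarrow> 'g) \<Rightarrow> 'g \<times> 'g \<Rightarrow> 'g \<times> 'g \<Rightarrow> 'g \<times> 'g" where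
  "gcomp \<tau> (u1, v1) (u2, v2) = (u2 + \<tau> v1, v2 + v1)"

lemma gcomp_in_gHom:
  fixes \<sigma> \<tau> :: "'g::group_add \<Rightarrow> 'g"
  assumes \<sigma>: "\<And>x y. \<sigma> (x + y) = \<sigma> x + \<sigma> y" and \<tau>: "\<And>x y. \<tau> (x + y) = \<tau> x + \<tau> y"
    and \<phi>: "\<phi> \<in> gHom \<sigma> \<tau> a b" and \<psi>: "\<psi> \<in> gHom \<sigma> \<tau> b c"
  shows "gcomp \<tau> \<phi> \<psi> \<in> gHom \<sigma> \<tau> a c"
proof -
  obtain u1 v1 u2 v2 where [simp]: "\<phi> = (u1, v1)" "\<psi> = (u2, v2)"
    by (cases \<phi>, cases \<psi>)
  have \<tau>0: "\<tau> 0 = 0"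
    using \<tau> [of 0 0] by (metis add.right_neutral add_left_imp_eq)
  have \<tau>m: "\<tau> (- x) = - \<tau> x" for x
    using \<tau> [of "- x" x] \<tau>0 by (simp add: eq_neg_iff_add_eq_0)
  have \<tau>d: "\<tau> (x - y) = \<tau> x - \<tau> y" for x y
    using \<tau> [of x "- y"] \<tau>m by simp
  have a: "\<sigma> (- v1) + u1 = a" and b: "u1 + \<tau> (- v1) = b" "\<sigma> (- v2) + u2 = b"
    and c: "u2 + \<tau> (- v2) = c"
    using \<phi> \<psi> by (auto simp: gHom_def)
  have "\<sigma> (- (v2 + v1)) + (u2 + \<tau> v1) = \<sigma> (- v1) + (\<sigma> (- v2) + u2) + \<tau> v1"
    using \<sigma> [of "- v1" "- v2"] by (simp add: minus_add add.assoc)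
  also have "\<sigma> (- v2) + u2 = u1 + \<tau> (- v1)"
    using b by simp
  finally have "\<sigma> (- (v2 + v1)) + (u2 + \<tau> v1) = a"
    using a by (simp add: \<tau>m add.assoc)
  moreover have "u2 + \<tau> v1 + \<tau> (- (v2 + v1)) = c"
    using c by (simp add: \<tau>d \<tau>m minus_add add_diff_eq)
  ultimately show ?thesis
    by (simp add: gHom_def)
qed

definition characters :: "('g::group_add \<Rightarrow> 'g) \<Rightarrow> ('g \<Rightarrow> 'g) \<Rightarrow> ('g \<times> 'g \<Rightarrow> complex) set" where
  "characters \<sigma> \<tau> = {\<chi>. \<forall>a b c. \<forall>\<phi>\<in>gHom \<sigma> \<tau> a b. \<forall>\<psi>\<in>gHom \<sigma> \<tau> b c.
     \<chi> (gcomp \<tau> \<phi> \<psi>) = \<chi> \<phi> + \<chi> \<psi>}"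

definition locally_finite :: "('g \<times> 'g \<Rightarrow> complex) \<Rightarrow> bool" where
  "locally_finite \<chi> \<longleftrightarrow> (\<forall>v. finite {u. \<chi> (u, v) \<noteq> 0})"

definition lf_characters :: "('g::group_add \<Rightarrow> 'g) \<Rightarrow> ('g \<Rightarrow> 'g) \<Rightarrow> ('g \<times> 'g \<Rightarrow> complex) set" where
  "lf_characters \<sigma> \<tau> = {\<chi> \<in> characters \<sigma> \<tau>. locally_finite \<chi>}"

definition Psi :: "('g group_algebra \<Rightarrow> 'g group_algebra) \<Rightarrow> 'g \<times> 'g \<Rightarrow> complex" where
  "Psi D = (\<lambda>(h, g). Poly_Mapping.lookup (D (basis_elt g)) h)"

definition linear_iso_on ::
    "('k::field \<Rightarrow> 'v::ab_group_add \<Rightarrow> 'v) \<Rightarrow> ('k \<Rightarrow> 'w::ab_group_add \<Rightarrow> 'w) \<Rightarrow>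
     'v set \<Rightarrow> 'w set \<Rightarrow> ('v \<Rightarrow> 'w) \<Rightarrow> bool" where
  "linear_iso_on s t V W f \<longleftrightarrow>
     vector_space s \<and> vector_space t \<and> module.subspace s V \<and> module.subspace t W \<and>
     (\<forall>x\<in>V. \<forall>y\<in>V. f (x + y) = f x + f y) \<and> (\<forall>c. \<forall>x\<in>V. f (s c x) = t c (f x)) \<and>
     bij_betw f V W"

lemma subspace_derivations: "module.subspace (fun_scale ga_scale) (derivations \<sigma> \<tau>)"
proof -
  interpret V: vector_space "ga_scale :: complex \<Rightarrow> 'a group_algebra \<Rightarrow> _"
    by (rule vector_space_ga_scale)
  interpret F: vector_space
      "fun_scale ga_scale :: complex \<Rightarrow> ('a group_algebra \<Rightarrow> 'a group_algebra) \<Rightarrow> _"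
    by (rule vector_space_fun_scale) (rule vector_space_ga_scale)
  interpret P: vector_space_pair "ga_scale :: complex \<Rightarrow> 'a group_algebra \<Rightarrow> _"
      "ga_scale :: complex \<Rightarrow> 'a group_algebra \<Rightarrow> _" ..
  show ?thesis
    unfolding F.subspace_def derivations_def fun_scale_def zero_fun_def plus_fun_def
    by (auto simp: P.linear_add P.linear_scale P.linear_zero P.linear_compose_add
        P.linear_compose_scale_right ga_scale_mult_left ga_scale_mult_right
        V.scale_right_distrib algebra_simps)
qed

lemma subspace_lf_characters: "module.subspace (fun_scale (*)) (lf_characters \<sigma> \<tau>)"
proof -
  interpret F: vector_space "fun_scale (*) :: complex \<Rightarrow> ('a \<times> 'a \<Rightarrow> complex) \<Rightarrow> _"
    by (rule vector_space_fun_scale) (rule vector_space_complex_mult)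
  have "finite {u. x (u, v) + y (u, v) \<noteq> 0}"
    if "finite {u. x (u, v) \<noteq> 0}" "finite {u. y (u, v) \<noteq> 0}" for x y :: "'a \<times> 'a \<Rightarrow> complex" and v
    by (rule finite_subset [OF _ finite_UnI [OF that]]) auto
  then show ?thesis
    unfolding F.subspace_def lf_characters_def characters_def locally_finite_def
      fun_scale_def zero_fun_def plus_fun_def
    by (auto simp: algebra_simps)
qed

end

theory Submission
  imports Defs
begin

text \<open>
  A linear map \<open>D\<close> on the group algebra is the same thing as the matrix of its coefficients
  \<open>\<lambda>(k, g)\<close> (the coefficient of \<open>k\<close> in \<open>D(g)\<close>), and this matrix is an arbitrary function on pairs
  with finite columns, which is exactly local finiteness (\<open>locally_finite_Psi\<close>, \<open>Psi_inj\<close>,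
  \<open>Psi_linear_extension\<close>).  It remains to match the Leibniz rule with additivity on the groupoid.
  Both sides of the Leibniz rule are bilinear, so it suffices to test it on basis elements
  (\<open>derivation_iff_basis\<close>).  In multiplicative notation, the coefficient of \<open>k\<close> in
  \<open>D(gh) = D(g)\<tau>(h) + \<sigma>(g)D(h)\<close> reads
  \<open>\<lambda>(k, gh) = \<lambda>(k\<tau>(h)\<inverse>, g) + \<lambda>(\<sigma>(g)\<inverse>k, h)\<close>.
  On the other hand, the morphisms \<open>(\<sigma>(g)\<inverse>k, h)\<close> and \<open>(k\<tau>(h)\<inverse>, g)\<close> are composable with composite
  \<open>(k, gh)\<close>, and every composable pair has this form for a unique triple \<open>(k, g, h)\<close>.  Hence
  additivity consists of the same equations (\<open>character_iff\<close>, \<open>derivation_iff_character\<close>).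
\<close>

section \<open>Additivity along the groupoid as a cocycle equation\<close>

lemma additive_uminus:
  fixes f :: "'g::group_add \<Rightarrow> 'g"
  assumes "\<And>x y. f (x + y) = f x + f y"
  shows "f (- x) = - f x"
proof -
  have "f 0 = 0"
    using assms [of 0 0] by (metis add.right_neutral add_left_imp_eq)
  then show ?thesis
    using assms [of "- x" x] by (simp add: eq_neg_iff_add_eq_0)
qed

text \<open>
  A composable pair is determined by its composite \<open>(k, g + h)\<close> together with the splitting of the
  second component: the common middle object forces the first components of the two factors.
\<close>

lemma character_iff:
  fixes \<sigma> \<tau> :: "'g::group_add \<Rightarrow> 'g"
  assumes \<sigma>: "\<And>x y. \<sigma> (x + y) = \<sigma> x + \<sigma> y" and \<tau>: "\<And>x y. \<tau> (x + y) = \<tau> x + \<tau> y"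
  shows "\<chi> \<in> characters \<sigma> \<tau> \<longleftrightarrow>
    (\<forall>g h k. \<chi> (k, g + h) = \<chi> (k - \<tau> h, g) + \<chi> (- \<sigma> g + k, h))"
    (is "?L \<longleftrightarrow> ?R")
proof
  assume \<chi>: ?L
  show ?R
  proof (intro allI)
    fix g h k
    have "(- \<sigma> g + k, h) \<in> gHom \<sigma> \<tau> (- \<sigma> h + (- \<sigma> g + k)) (- \<sigma> g + k - \<tau> h)"
      and "(k - \<tau> h, g) \<in> gHom \<sigma> \<tau> (- \<sigma> g + k - \<tau> h) (k - \<tau> h - \<tau> g)"
      by (simp_all add: gHom_def additive_uminus [of \<sigma>, OF \<sigma>] additive_uminus [of \<tau>, OF \<tau>]
          add_diff_eq)
    then have "\<chi> (gcomp \<tau> (- \<sigma> g + k, h) (k - \<tau> h, g)) = \<chi> (- \<sigma> g + k, h) + \<chi> (k - \<tau> h, g)"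
      using \<chi> unfolding characters_def by blast
    then show "\<chi> (k, g + h) = \<chi> (k - \<tau> h, g) + \<chi> (- \<sigma> g + k, h)"
      by (simp add: add.commute)
  qed
next
  assume R: ?R
  have "\<chi> (gcomp \<tau> \<phi> \<psi>) = \<chi> \<phi> + \<chi> \<psi>"
    if "\<phi> \<in> gHom \<sigma> \<tau> a b" "\<psi> \<in> gHom \<sigma> \<tau> b c" for a b c \<phi> \<psi>
  proof -
    obtain u1 v1 u2 v2 where [simp]: "\<phi> = (u1, v1)" "\<psi> = (u2, v2)"
      by (cases \<phi>, cases \<psi>)
    \<comment> \<open>equality of the target of \<open>\<phi>\<close> with the source of \<open>\<psi>\<close>\<close>
    have "- \<sigma> v2 + u2 = u1 - \<tau> v1"
      using that by (simp add: gHom_def additive_uminus [of \<sigma>, OF \<sigma>] additive_uminus [of \<tau>, OF \<tau>])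
    then have "- \<sigma> v2 + (u2 + \<tau> v1) = u1"
      by (simp flip: add.assoc)
    then show ?thesis
      using R [rule_format, of "u2 + \<tau> v1" v2 v1] by (simp add: add.commute)
  qed
  then show ?L
    unfolding characters_def by blast
qed

section \<open>Linear maps on the group algebra and their coefficients\<close>

interpretation ga: vector_space "ga_scale :: complex \<Rightarrow> 'g group_algebra \<Rightarrow> 'g group_algebra"
  by (rule vector_space_ga_scale)

interpretation ga_pair: vector_space_pair
    "ga_scale :: complex \<Rightarrow> 'g group_algebra \<Rightarrow> 'g group_algebra"
    "ga_scale :: complex \<Rightarrow> 'h group_algebra \<Rightarrow> 'h group_algebra" ..

lemma linear_ga_scaleI:
  assumes "\<And>a b. f (a + b) = f a + f b" "\<And>c a. f (ga_scale c a) = ga_scale c (f a)"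
  shows "Vector_Spaces.linear ga_scale ga_scale f"
  using assms by (simp add: Vector_Spaces.linear_iff vector_space_ga_scale)

lemma linear_basis_expansion:
  assumes "Vector_Spaces.linear ga_scale ga_scale D"
  shows "D a = (\<Sum>g\<in>Poly_Mapping.keys a. ga_scale (Poly_Mapping.lookup a g) (D (basis_elt g)))"
proof -
  have "(\<Sum>g\<in>Poly_Mapping.keys a. ga_scale (Poly_Mapping.lookup a g) (basis_elt g)) = a"
    by (simp flip: single_sum_keys)
  then have "D a = D (\<Sum>g\<in>Poly_Mapping.keys a. ga_scale (Poly_Mapping.lookup a g) (basis_elt g))"
    by (simp only:)
  then show ?thesis
    by (simp only: ga_pair.linear_sum [OF assms] ga_pair.linear_scale [OF assms])
qed

lemma linear_eq_on_basis_elts: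
  assumes "Vector_Spaces.linear ga_scale ga_scale D" "Vector_Spaces.linear ga_scale ga_scale E"
    and "\<And>g. D (basis_elt g) = E (basis_elt g)"
  shows "D = E"
  by (rule ext, subst linear_basis_expansion [OF assms(1)], subst linear_basis_expansion [OF assms(2)])
    (simp add: assms(3))

text \<open>
  Existence half of the universal property of the basis \<open>G\<close>: a linear map may be prescribed freely
  on it.
\<close>

definition linear_extension ::
    "('g \<Rightarrow> 'g group_algebra) \<Rightarrow> 'g group_algebra \<Rightarrow> 'g group_algebra" where
  "linear_extension f a = (\<Sum>g\<in>Poly_Mapping.keys a. ga_scale (Poly_Mapping.lookup a g) (f g))"

lemma linear_extension_basis_elt [simp]: "linear_extension f (basis_elt g) = f g"
  by (simp add: linear_extension_def)

lemma linear_extension_superset: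
  assumes "finite S" "Poly_Mapping.keys a \<subseteq> S"
  shows "linear_extension f a = (\<Sum>g\<in>S. ga_scale (Poly_Mapping.lookup a g) (f g))"
  unfolding linear_extension_def
  by (rule sum.mono_neutral_left) (use assms in \<open>auto simp: in_keys_iff\<close>)

lemma linear_linear_extension: "Vector_Spaces.linear ga_scale ga_scale (linear_extension f)"
proof (rule linear_ga_scaleI)
  fix a b :: "'a group_algebra"
  let ?S = "Poly_Mapping.keys a \<union> Poly_Mapping.keys b"
  have "Poly_Mapping.keys (a + b) \<subseteq> ?S"
    by (rule Poly_Mapping.keys_add)
  then show "linear_extension f (a + b) = linear_extension f a + linear_extension f b"
    by (simp add: linear_extension_superset [of ?S] lookup_add ga.scale_left_distrib sum.distrib)
next
  fix c :: complex and a :: "'a group_algebra"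
  have "Poly_Mapping.keys (ga_scale c a) \<subseteq> Poly_Mapping.keys a"
    by (auto simp: in_keys_iff)
  then show "linear_extension f (ga_scale c a) = ga_scale c (linear_extension f a)"
    by (simp add: linear_extension_superset [of "Poly_Mapping.keys a"] ga.scale_sum_right)
qed

lemma Psi_inj:
  assumes "Vector_Spaces.linear ga_scale ga_scale D" "Vector_Spaces.linear ga_scale ga_scale E"
    and "Psi D = Psi E"
  shows "D = E"
proof (rule linear_eq_on_basis_elts [OF assms(1,2)])
  fix g
  show "D (basis_elt g) = E (basis_elt g)"
    using fun_cong [OF assms(3), of "(_, g)"] by (auto intro!: poly_mapping_eqI simp: Psi_def)
qed

lemma locally_finite_Psi: "locally_finite (Psi D)"
  by (simp add: locally_finite_def Psi_def finite_lookup)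

definition column :: "('g \<times> 'g \<Rightarrow> complex) \<Rightarrow> 'g \<Rightarrow> 'g group_algebra" where
  "column \<chi> g = (\<Sum>h | \<chi> (h, g) \<noteq> 0. ga_scale (\<chi> (h, g)) (basis_elt h))"

text \<open>Local finiteness is needed because a sum over an infinite set of rows would be read as \<open>0\<close>.\<close>

lemma lookup_column:
  assumes "locally_finite \<chi>"
  shows "Poly_Mapping.lookup (column \<chi> g) k = \<chi> (k, g)"
proof -
  have "finite {h. \<chi> (h, g) \<noteq> 0}"
    using assms by (simp add: locally_finite_def)
  then show ?thesis
    by (simp add: column_def lookup_sum lookup_single when_def)
qed

lemma Psi_linear_extension:
  assumes "locally_finite \<chi>"
  shows "Psi (linear_extension (column \<chi>)) = \<chi>"
  by (auto simp: Psi_def lookup_column [OF assms])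

section \<open>The Leibniz rule on basis elements\<close>

lemma linear_times_left:
  fixes c :: "'g::group_add group_algebra"
  shows "Vector_Spaces.linear ga_scale ga_scale ((*) c)"
  by (rule linear_ga_scaleI) (simp_all add: distrib_left ga_scale_mult_right)

lemma linear_times_right:
  fixes c :: "'g::group_add group_algebra"
  shows "Vector_Spaces.linear ga_scale ga_scale (\<lambda>a. a * c)"
  by (rule linear_ga_scaleI) (simp_all add: distrib_right ga_scale_mult_left)

lemma linear_lin_ext: "Vector_Spaces.linear ga_scale ga_scale (lin_ext \<sigma>)"
  by (rule linear_ga_scaleI) (simp_all add: lin_ext_add lin_ext_ga_scale)

lemma linear_comp:
  fixes f g :: "'g group_algebra \<Rightarrow> 'g group_algebra"
  assumes "Vector_Spaces.linear ga_scale ga_scale f" "Vector_Spaces.linear ga_scale ga_scale g"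
  shows "Vector_Spaces.linear ga_scale ga_scale (\<lambda>a. f (g a))"
  using Vector_Spaces.linear_compose [OF assms(2,1)] by (simp add: comp_def)

lemma derivation_iff_basis:
  fixes \<sigma> \<tau> :: "'g::group_add \<Rightarrow> 'g"
  assumes D: "Vector_Spaces.linear ga_scale ga_scale D"
  shows "D \<in> derivations \<sigma> \<tau> \<longleftrightarrow>
    (\<forall>g h. D (basis_elt (g + h)) =
      D (basis_elt g) * basis_elt (\<tau> h) + basis_elt (\<sigma> g) * D (basis_elt h))"
    (is "?L \<longleftrightarrow> ?R")
proof
  assume ?L
  then have "D (basis_elt g * basis_elt h) =
      D (basis_elt g) * lin_ext \<tau> (basis_elt h) + lin_ext \<sigma> (basis_elt g) * D (basis_elt h)" for g h
    unfolding derivations_def by blast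
  then show ?R
    by (simp add: mult_single)
next
  assume R: ?R
  note lin = ga_pair.linear_compose_add linear_comp [OF D] linear_comp [OF linear_times_left]
    linear_comp [OF linear_times_right] linear_times_left linear_times_right linear_lin_ext D
  \<comment> \<open>the Leibniz rule is linear in the second argument, then in the first one\<close>
  have 1: "(\<lambda>b. D (basis_elt g * b)) =
      (\<lambda>b. D (basis_elt g) * lin_ext \<tau> b + basis_elt (\<sigma> g) * D b)" for g
    by (rule linear_eq_on_basis_elts) (intro lin, intro lin, simp add: mult_single R)
  have 2: "(\<lambda>a. D (a * b)) = (\<lambda>a. D a * lin_ext \<tau> b + lin_ext \<sigma> a * D b)" for b
    by (rule linear_eq_on_basis_elts) (intro lin, intro lin, simp add: fun_cong [OF 1])
  show ?L
    using D fun_cong [OF 2] by (simp add: derivations_def)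
qed

lemma lookup_mult_basis_elt:
  fixes a :: "'g::group_add group_algebra"
  shows "Poly_Mapping.lookup (a * basis_elt g) k = Poly_Mapping.lookup a (k - g)"
proof -
  have "a * basis_elt g =
      (\<Sum>x\<in>Poly_Mapping.keys a. Poly_Mapping.single (x + g) (Poly_Mapping.lookup a x))"
    by (subst single_sum_keys [of a]) (simp add: sum_distrib_right mult_single)
  moreover have "x + g = k \<longleftrightarrow> x = k - g" for x
    by (simp add: eq_diff_eq)
  ultimately show ?thesis
    by (simp add: lookup_sum lookup_single when_def in_keys_iff)
qed

lemma lookup_basis_elt_mult:
  fixes a :: "'g::group_add group_algebra"
  shows "Poly_Mapping.lookup (basis_elt g * a) k = Poly_Mapping.lookup a (- g + k)"
proof -
  have "basis_elt g * a =
      (\<Sum>x\<in>Poly_Mapping.keys a. Poly_Mapping.single (g + x) (Poly_Mapping.lookup a x))"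
    by (subst single_sum_keys [of a]) (simp add: sum_distrib_left mult_single)
  moreover have "g + x = k \<longleftrightarrow> x = - g + k" for x
    by (metis add_minus_cancel minus_add_cancel)
  ultimately show ?thesis
    by (simp add: lookup_sum lookup_single when_def in_keys_iff)
qed

text \<open>
  The \<open>k\<close>-th coefficient of the Leibniz rule for \<open>g\<close> and \<open>h\<close> is the cocycle equation of
  \<open>character_iff\<close>.
\<close>

lemma derivation_iff_character:
  fixes \<sigma> \<tau> :: "'g::group_add \<Rightarrow> 'g"
  assumes "\<And>x y. \<sigma> (x + y) = \<sigma> x + \<sigma> y" "\<And>x y. \<tau> (x + y) = \<tau> x + \<tau> y"
    and "Vector_Spaces.linear ga_scale ga_scale D"
  shows "D \<in> derivations \<sigma> \<tau> \<longleftrightarrow> Psi D \<in> characters \<sigma> \<tau>"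
  unfolding derivation_iff_basis [OF assms(3)] character_iff [of \<sigma> \<tau>, OF assms(1,2)]
  by (simp add: poly_mapping_eq_iff fun_eq_iff lookup_add lookup_mult_basis_elt
      lookup_basis_elt_mult Psi_def)

section \<open>The isomorphism\<close>

lemma derivations_linear: "D \<in> derivations \<sigma> \<tau> \<Longrightarrow> Vector_Spaces.linear ga_scale ga_scale D"
  by (simp add: derivations_def)

lemma Psi_lf_characters:
  fixes \<sigma> \<tau> :: "'g::group_add \<Rightarrow> 'g"
  assumes "\<And>x y. \<sigma> (x + y) = \<sigma> x + \<sigma> y" "\<And>x y. \<tau> (x + y) = \<tau> x + \<tau> y"
    and "D \<in> derivations \<sigma> \<tau>"
  shows "Psi D \<in> lf_characters \<sigma> \<tau>"
  using derivation_iff_character [of \<sigma> \<tau>, OF assms(1,2) derivations_linear [OF assms(3)]] assms(3)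
  by (simp add: lf_characters_def locally_finite_Psi)

lemma linear_extension_derivation:
  fixes \<sigma> \<tau> :: "'g::group_add \<Rightarrow> 'g"
  assumes "\<And>x y. \<sigma> (x + y) = \<sigma> x + \<sigma> y" "\<And>x y. \<tau> (x + y) = \<tau> x + \<tau> y"
    and "\<chi> \<in> lf_characters \<sigma> \<tau>"
  shows "linear_extension (column \<chi>) \<in> derivations \<sigma> \<tau>"
  using derivation_iff_character [of \<sigma> \<tau>, OF assms(1,2) linear_linear_extension] assms(3)
  by (simp add: lf_characters_def Psi_linear_extension)

theorem theorem1:
  fixes \<sigma> \<tau> :: "'g::group_add \<Rightarrow> 'g"
  assumes "countable (UNIV :: 'g set)"
    and "\<And>x y. \<sigma> (x + y) = \<sigma> x + \<sigma> y"
    and "\<And>x y. \<tau> (x + y) = \<tau> x + \<tau> y"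
  shows "linear_iso_on (fun_scale ga_scale) (fun_scale (*))
           (derivations \<sigma> \<tau>) (lf_characters \<sigma> \<tau>) Psi
       \<and> (\<forall>\<chi>\<in>lf_characters \<sigma> \<tau>. \<forall>g.
            inv_into (derivations \<sigma> \<tau>) Psi \<chi> (basis_elt g)
              = (\<Sum>h | \<chi> (h, g) \<noteq> 0. ga_scale (\<chi> (h, g)) (basis_elt h)))"
proof -
  note ext_der = linear_extension_derivation [of \<sigma> \<tau>, OF assms(2,3)]
  have Psi_ext: "Psi (linear_extension (column \<chi>)) = \<chi>" if "\<chi> \<in> lf_characters \<sigma> \<tau>" for \<chi>
    using that by (simp add: lf_characters_def Psi_linear_extension)
  have inj: "inj_on Psi (derivations \<sigma> \<tau>)"
    by (auto intro!: inj_onI Psi_inj derivations_linear)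
  have "Psi ` derivations \<sigma> \<tau> = lf_characters \<sigma> \<tau>"
  proof
    show "Psi ` derivations \<sigma> \<tau> \<subseteq> lf_characters \<sigma> \<tau>"
      using Psi_lf_characters [of \<sigma> \<tau>, OF assms(2,3)] by blast
    show "lf_characters \<sigma> \<tau> \<subseteq> Psi ` derivations \<sigma> \<tau>"
      using ext_der Psi_ext by (metis image_eqI subsetI)
  qed
  with inj have "bij_betw Psi (derivations \<sigma> \<tau>) (lf_characters \<sigma> \<tau>)"
    by (simp add: bij_betw_def)
  moreover have "Psi (D + E) = Psi D + Psi E" for D E :: "'g group_algebra \<Rightarrow> 'g group_algebra"
    by (auto simp: Psi_def lookup_add)
  moreover have "Psi (fun_scale ga_scale c D) = fun_scale (*) c (Psi D)"
    for c and D :: "'g group_algebra \<Rightarrow> 'g group_algebra"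
    by (auto simp: Psi_def fun_scale_def)
  moreover have "inv_into (derivations \<sigma> \<tau>) Psi \<chi> = linear_extension (column \<chi>)"
    if "\<chi> \<in> lf_characters \<sigma> \<tau>" for \<chi>
    using inv_into_f_f [OF inj ext_der [OF that]] by (simp add: Psi_ext [OF that])
  ultimately show ?thesis
    by (simp add: linear_iso_on_def vector_space_fun_scale vector_space_ga_scale
        vector_space_complex_mult subspace_derivations subspace_lf_characters column_def)
qed

end
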